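(* Let $n>1$ and let $\{e_1,\dots,e_n\}$ be a complete set of orthogonal idempotents of a ring $R$. The following conditions are equivalent: (1) $R^\pi\in\mathcal{T}_n$. (2) $e_iRe_jRe_i=0$ for all $i\neq j$. (3) $\{e_1,\dots,e_n\}\subseteq\mathfrak{P}_{\rm it}(R)$. (4) $\mathcal{D}(R^\pi)^-$ is a right ideal of $R^\pi$.
   Context: All rings are associative with unity. A complete set of orthogonal idempotents is a set of pairwise orthogonal idempotents with sum $1$. $R^\pi$ is the $n$-by-$n$ array with $(i,j)$-position $e_iRe_j$, a ring under componentwise addition and row-column multiplication (isomorphic to $R$ via $x\mapsto[e_ixe_j]$); it is a generalized matrix ring with diagonal rings $e_iRe_i$, bimodules $M_{ij}=e_iRe_j$, and homomorphisms $\theta_{ijk}:e_iRe_j\otimes_{e_jRe_j}e_jRe_k\to e_iRe_k$ given by multiplication in $R$. For $n>1$, $\mathcal{T}_n$ is the class of $n$-by-$n$ generalized matrix rings with $\theta_{iji}=0$ for all $i\neq j$. $\mathcal{D}(R^\pi)^-=\{[r_{ij}]\in R^\pi\mid r_{ii}=0\text{ for all } i\}$. An idempotent $e\in R$ is inner Peirce trivial if $exye=exeye$ for all $x,y\in R$ (equivalently $eR(1-e)Re=0$); $\mathfrak{P}_{\rm it}(R)$ is the set of inner Peirce trivial idempotents of $R$. *)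

theory Defs
  imports "HOL-Algebra.Ideal" "HOL-Algebra.Free_Abelian_Groups"
begin

section \<open>Bimodules and tensor products over noncommutative rings\<close>

text \<open>
  The additive group of a bimodule is a commutative group in the sense of HOL-Algebra; its
  operation is thus written multiplicatively, and its zero element is \<open>\<one>\<close>.
\<close>

definition bimodule ::
  "('a, 'p) ring_scheme \<Rightarrow> ('b, 'q) ring_scheme \<Rightarrow> ('c, 's) monoid_scheme \<Rightarrow>
    ('a \<Rightarrow> 'c \<Rightarrow> 'c) \<Rightarrow> ('c \<Rightarrow> 'b \<Rightarrow> 'c) \<Rightarrow> bool" where
  "bimodule R S M l r \<longleftrightarrow>
     ring R \<and> ring S \<and> comm_group M \<and>
     (\<forall>a\<in>carrier R. l a \<in> hom M M) \<and>
     (\<forall>a\<in>carrier R. \<forall>b\<in>carrier R. \<forall>x\<in>carrier M.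
        l (a \<oplus>\<^bsub>R\<^esub> b) x = l a x \<otimes>\<^bsub>M\<^esub> l b x \<and> l (a \<otimes>\<^bsub>R\<^esub> b) x = l a (l b x)) \<and>
     (\<forall>x\<in>carrier M. l \<one>\<^bsub>R\<^esub> x = x) \<and>
     (\<forall>a\<in>carrier S. (\<lambda>x. r x a) \<in> hom M M) \<and>
     (\<forall>a\<in>carrier S. \<forall>b\<in>carrier S. \<forall>x\<in>carrier M.
        r x (a \<oplus>\<^bsub>S\<^esub> b) = r x a \<otimes>\<^bsub>M\<^esub> r x b \<and> r x (a \<otimes>\<^bsub>S\<^esub> b) = r (r x a) b) \<and>
     (\<forall>x\<in>carrier M. r x \<one>\<^bsub>S\<^esub> = x) \<and>
     (\<forall>a\<in>carrier R. \<forall>b\<in>carrier S. \<forall>x\<in>carrier M. l a (r x b) = r (l a x) b)"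

text \<open>
  \<open>M \<otimes>\<^sub>S N\<close> for a right \<open>S\<close>-module \<open>M\<close> (action \<open>r\<close>) and a left \<open>S\<close>-module \<open>N\<close> (action \<open>l\<close>):
  the free abelian group on pairs modulo the subgroup generated by the usual relations.
\<close>

definition tensor_relations ::
  "('s, 'q) ring_scheme \<Rightarrow> ('a, 'p) monoid_scheme \<Rightarrow> ('a \<Rightarrow> 's \<Rightarrow> 'a) \<Rightarrow>
    ('b, 't) monoid_scheme \<Rightarrow> ('s \<Rightarrow> 'b \<Rightarrow> 'b) \<Rightarrow> (('a \<times> 'b) \<Rightarrow>\<^sub>0 int) set" where
  "tensor_relations S M r N l =
     {frag_of (x \<otimes>\<^bsub>M\<^esub> x', y) - frag_of (x, y) - frag_of (x', y) | x x' y.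
        x \<in> carrier M \<and> x' \<in> carrier M \<and> y \<in> carrier N} \<union>
     {frag_of (x, y \<otimes>\<^bsub>N\<^esub> y') - frag_of (x, y) - frag_of (x, y') | x y y'.
        x \<in> carrier M \<and> y \<in> carrier N \<and> y' \<in> carrier N} \<union>
     {frag_of (r x s, y) - frag_of (x, l s y) | x s y.
        x \<in> carrier M \<and> s \<in> carrier S \<and> y \<in> carrier N}"

definition tensor_subgroup ::
  "('s, 'q) ring_scheme \<Rightarrow> ('a, 'p) monoid_scheme \<Rightarrow> ('a \<Rightarrow> 's \<Rightarrow> 'a) \<Rightarrow>
    ('b, 't) monoid_scheme \<Rightarrow> ('s \<Rightarrow> 'b \<Rightarrow> 'b) \<Rightarrow> (('a \<times> 'b) \<Rightarrow>\<^sub>0 int) set" where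
  "tensor_subgroup S M r N l =
     generate (free_Abelian_group (carrier M \<times> carrier N)) (tensor_relations S M r N l)"

definition tensor_product ::
  "('s, 'q) ring_scheme \<Rightarrow> ('a, 'p) monoid_scheme \<Rightarrow> ('a \<Rightarrow> 's \<Rightarrow> 'a) \<Rightarrow>
    ('b, 't) monoid_scheme \<Rightarrow> ('s \<Rightarrow> 'b \<Rightarrow> 'b) \<Rightarrow> (('a \<times> 'b) \<Rightarrow>\<^sub>0 int) set monoid" where
  "tensor_product S M r N l =
     free_Abelian_group (carrier M \<times> carrier N) Mod tensor_subgroup S M r N l"

definition pure_tensor ::
  "('s, 'q) ring_scheme \<Rightarrow> ('a, 'p) monoid_scheme \<Rightarrow> ('a \<Rightarrow> 's \<Rightarrow> 'a) \<Rightarrow>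
    ('b, 't) monoid_scheme \<Rightarrow> ('s \<Rightarrow> 'b \<Rightarrow> 'b) \<Rightarrow> 'a \<Rightarrow> 'b \<Rightarrow> (('a \<times> 'b) \<Rightarrow>\<^sub>0 int) set" where
  "pure_tensor S M r N l x y =
     tensor_subgroup S M r N l #>\<^bsub>free_Abelian_group (carrier M \<times> carrier N)\<^esub> frag_of (x, y)"

section \<open>Generalized matrix rings\<close>

text \<open>
  A generalized matrix ring is a ring of arrays together with its diagonal rings \<open>R\<^sub>i\<close>, its
  bimodules \<open>M\<^sub>i\<^sub>j\<close> (with left and right actions) and its homomorphisms
  \<open>\<theta>\<^sub>i\<^sub>j\<^sub>k : M\<^sub>i\<^sub>j \<otimes> M\<^sub>j\<^sub>k \<rightarrow> M\<^sub>i\<^sub>k\<close>, the tensor product being over \<open>R\<^sub>j\<close>. Rows and columns are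
  indexed by \<open>{1..n}\<close>.
\<close>

record 'a gmr = "(nat \<Rightarrow> nat \<Rightarrow> 'a) ring" +
  diag_ring :: "nat \<Rightarrow> 'a ring"
  bim :: "nat \<Rightarrow> nat \<Rightarrow> 'a monoid"
  lact :: "nat \<Rightarrow> nat \<Rightarrow> 'a \<Rightarrow> 'a \<Rightarrow> 'a"
  ract :: "nat \<Rightarrow> nat \<Rightarrow> 'a \<Rightarrow> 'a \<Rightarrow> 'a"
  theta :: "nat \<Rightarrow> nat \<Rightarrow> nat \<Rightarrow> (('a \<times> 'a) \<Rightarrow>\<^sub>0 int) set \<Rightarrow> 'a"

definition gmr_tensor ::
  "('a, 'z) gmr_scheme \<Rightarrow> nat \<Rightarrow> nat \<Rightarrow> nat \<Rightarrow> (('a \<times> 'a) \<Rightarrow>\<^sub>0 int) set monoid" where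
  "gmr_tensor G i j k =
     tensor_product (diag_ring G j) (bim G i j) (ract G i j) (bim G j k) (lact G j k)"

definition gmr_pure ::
  "('a, 'z) gmr_scheme \<Rightarrow> nat \<Rightarrow> nat \<Rightarrow> nat \<Rightarrow> 'a \<Rightarrow> 'a \<Rightarrow> (('a \<times> 'a) \<Rightarrow>\<^sub>0 int) set" where
  "gmr_pure G i j k x y =
     pure_tensor (diag_ring G j) (bim G i j) (ract G i j) (bim G j k) (lact G j k) x y"

text \<open>
  Compatibility of \<open>\<theta>\<^sub>i\<^sub>j\<^sub>k\<close> with the outer actions is stated on pure tensors, where
  \<open>a \<cdot> (x \<otimes> y) = (a \<cdot> x) \<otimes> y\<close> and \<open>(x \<otimes> y) \<cdot> b = x \<otimes> (y \<cdot> b)\<close>; these generate the tensor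
  product. The associativity conditions relating the various \<open>\<theta>\<^sub>i\<^sub>j\<^sub>k\<close> are contained in the
  requirement that the arrays form a ring under row-column multiplication.
\<close>

definition generalized_matrix_ring :: "nat \<Rightarrow> ('a, 'z) gmr_scheme \<Rightarrow> bool" where
  "generalized_matrix_ring n G \<longleftrightarrow>
     ring G \<and>
     carrier G = (\<Pi>\<^sub>E i\<in>{1..n}. \<Pi>\<^sub>E j\<in>{1..n}. carrier (bim G i j)) \<and>
     (\<forall>A\<in>carrier G. \<forall>B\<in>carrier G. \<forall>i\<in>{1..n}. \<forall>j\<in>{1..n}.
        (A \<oplus>\<^bsub>G\<^esub> B) i j = A i j \<otimes>\<^bsub>bim G i j\<^esub> B i j \<and>
        (A \<otimes>\<^bsub>G\<^esub> B) i j =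
          finprod (bim G i j) (\<lambda>k. theta G i k j (gmr_pure G i k j (A i k) (B k j))) {1..n}) \<and>
     (\<forall>i\<in>{1..n}. bim G i i = add_monoid (diag_ring G i)) \<and>
     (\<forall>i\<in>{1..n}. \<forall>x\<in>carrier (diag_ring G i). \<forall>y\<in>carrier (diag_ring G i).
        lact G i i x y = x \<otimes>\<^bsub>diag_ring G i\<^esub> y \<and> ract G i i x y = x \<otimes>\<^bsub>diag_ring G i\<^esub> y) \<and>
     (\<forall>i\<in>{1..n}. \<forall>j\<in>{1..n}.
        bimodule (diag_ring G i) (diag_ring G j) (bim G i j) (lact G i j) (ract G i j)) \<and>
     (\<forall>i\<in>{1..n}. \<forall>j\<in>{1..n}. \<forall>k\<in>{1..n}.
        theta G i j k \<in> hom (gmr_tensor G i j k) (bim G i k) \<and>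
        (\<forall>x\<in>carrier (bim G i j). \<forall>y\<in>carrier (bim G j k).
           (\<forall>a\<in>carrier (diag_ring G i).
              theta G i j k (gmr_pure G i j k (lact G i j a x) y) =
              lact G i k a (theta G i j k (gmr_pure G i j k x y))) \<and>
           (\<forall>b\<in>carrier (diag_ring G k).
              theta G i j k (gmr_pure G i j k x (ract G j k y b)) =
              ract G i k (theta G i j k (gmr_pure G i j k x y)) b))) \<and>
     (\<forall>i\<in>{1..n}. \<forall>j\<in>{1..n}. \<forall>x\<in>carrier (bim G i j).
        (\<forall>a\<in>carrier (diag_ring G i). theta G i i j (gmr_pure G i i j a x) = lact G i j a x) \<and>
        (\<forall>b\<in>carrier (diag_ring G j). theta G i j j (gmr_pure G i j j x b) = ract G i j x b))"

definition gmr_class_T :: "nat \<Rightarrow> 'a gmr set" where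
  "gmr_class_T n =
     {G. generalized_matrix_ring n G \<and>
         (\<forall>i\<in>{1..n}. \<forall>j\<in>{1..n}. i \<noteq> j \<longrightarrow>
            (\<forall>t\<in>carrier (gmr_tensor G i j i). theta G i j i t = \<one>\<^bsub>bim G i i\<^esub>))}"

definition zero_diagonal_arrays :: "nat \<Rightarrow> ('a, 'z) gmr_scheme \<Rightarrow> (nat \<Rightarrow> nat \<Rightarrow> 'a) set" where
  "zero_diagonal_arrays n G = {A \<in> carrier G. \<forall>i\<in>{1..n}. A i i = \<zero>\<^bsub>diag_ring G i\<^esub>}"

section \<open>Peirce decompositions\<close>

definition complete_orthogonal_idempotents ::
  "('a, 'm) ring_scheme \<Rightarrow> nat \<Rightarrow> (nat \<Rightarrow> 'a) \<Rightarrow> bool" where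
  "complete_orthogonal_idempotents R n e \<longleftrightarrow>
     (\<forall>i\<in>{1..n}. e i \<in> carrier R \<and> e i \<otimes>\<^bsub>R\<^esub> e i = e i) \<and>
     (\<forall>i\<in>{1..n}. \<forall>j\<in>{1..n}. i \<noteq> j \<longrightarrow> e i \<otimes>\<^bsub>R\<^esub> e j = \<zero>\<^bsub>R\<^esub>) \<and>
     (\<Oplus>\<^bsub>R\<^esub>i\<in>{1..n}. e i) = \<one>\<^bsub>R\<^esub>"

definition peirce_part :: "('a, 'm) ring_scheme \<Rightarrow> 'a \<Rightarrow> 'a \<Rightarrow> 'a set" where
  "peirce_part R e f = {e \<otimes>\<^bsub>R\<^esub> x \<otimes>\<^bsub>R\<^esub> f | x. x \<in> carrier R}"

definition peirce_diag_ring :: "('a, 'm) ring_scheme \<Rightarrow> 'a \<Rightarrow> 'a ring" where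
  "peirce_diag_ring R e =
     \<lparr>carrier = peirce_part R e e, monoid.mult = monoid.mult R, one = e, ring.zero = \<zero>\<^bsub>R\<^esub>, ring.add = ring.add R\<rparr>"

text \<open>
  On formal integer combinations of pairs, the map sending \<open>(x, y)\<close> to \<open>x y\<close>. It is constant on
  the cosets making up a tensor product, so \<open>peirce_theta\<close> is the map it induces there:
  the one with \<open>x \<otimes> y \<mapsto> x y\<close>.
\<close>

definition mult_eval :: "('a, 'm) ring_scheme \<Rightarrow> (('a \<times> 'a) \<Rightarrow>\<^sub>0 int) \<Rightarrow> 'a" where
  "mult_eval R c =
     (\<Oplus>\<^bsub>R\<^esub>p\<in>Poly_Mapping.keys c. [Poly_Mapping.lookup c p] \<cdot>\<^bsub>R\<^esub> (fst p \<otimes>\<^bsub>R\<^esub> snd p))"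

definition peirce_theta :: "('a, 'm) ring_scheme \<Rightarrow> (('a \<times> 'a) \<Rightarrow>\<^sub>0 int) set \<Rightarrow> 'a" where
  "peirce_theta R t = the_elem (mult_eval R ` t)"

definition peirce_ring :: "('a, 'm) ring_scheme \<Rightarrow> nat \<Rightarrow> (nat \<Rightarrow> 'a) \<Rightarrow> 'a gmr" where
  "peirce_ring R n e =
     \<lparr>carrier = (\<Pi>\<^sub>E i\<in>{1..n}. \<Pi>\<^sub>E j\<in>{1..n}. peirce_part R (e i) (e j)),
      monoid.mult = (\<lambda>A B. \<lambda>i\<in>{1..n}. \<lambda>j\<in>{1..n}. \<Oplus>\<^bsub>R\<^esub>k\<in>{1..n}. A i k \<otimes>\<^bsub>R\<^esub> B k j),
      one = (\<lambda>i\<in>{1..n}. \<lambda>j\<in>{1..n}. if i = j then e i else \<zero>\<^bsub>R\<^esub>),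
      ring.zero = (\<lambda>i\<in>{1..n}. \<lambda>j\<in>{1..n}. \<zero>\<^bsub>R\<^esub>),
      ring.add = (\<lambda>A B. \<lambda>i\<in>{1..n}. \<lambda>j\<in>{1..n}. A i j \<oplus>\<^bsub>R\<^esub> B i j),
      diag_ring = (\<lambda>i. peirce_diag_ring R (e i)),
      bim = (\<lambda>i j. \<lparr>carrier = peirce_part R (e i) (e j), monoid.mult = ring.add R, one = \<zero>\<^bsub>R\<^esub>\<rparr>),
      lact = (\<lambda>i j. monoid.mult R),
      ract = (\<lambda>i j. monoid.mult R),
      theta = (\<lambda>i j k. peirce_theta R)\<rparr>"

text \<open>As usual for additive subgroups, \<open>eRfRe\<close> consists of the finite sums of products.\<close>

definition peirce_triple :: "('a, 'm) ring_scheme \<Rightarrow> 'a \<Rightarrow> 'a \<Rightarrow> 'a set" where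
  "peirce_triple R e f =
     generate (add_monoid R)
       {e \<otimes>\<^bsub>R\<^esub> x \<otimes>\<^bsub>R\<^esub> f \<otimes>\<^bsub>R\<^esub> y \<otimes>\<^bsub>R\<^esub> e | x y. x \<in> carrier R \<and> y \<in> carrier R}"

definition inner_peirce_trivial :: "('a, 'm) ring_scheme \<Rightarrow> 'a set" where
  "inner_peirce_trivial R =
     {e \<in> carrier R. e \<otimes>\<^bsub>R\<^esub> e = e \<and>
        (\<forall>x\<in>carrier R. \<forall>y\<in>carrier R.
           e \<otimes>\<^bsub>R\<^esub> x \<otimes>\<^bsub>R\<^esub> y \<otimes>\<^bsub>R\<^esub> e = e \<otimes>\<^bsub>R\<^esub> x \<otimes>\<^bsub>R\<^esub> e \<otimes>\<^bsub>R\<^esub> y \<otimes>\<^bsub>R\<^esub> e)}"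

locale right_ideal = additive_subgroup I R + ring R for I and R (structure) +
  assumes I_r_closed: "\<lbrakk>a \<in> I; x \<in> carrier R\<rbrakk> \<Longrightarrow> a \<otimes> x \<in> I"

end

theory Submission
  imports Defs "HOL-Algebra.QuotRing"
begin

text \<open>
  Write \<open>P\<^sub>i\<^sub>j = e\<^sub>i R e\<^sub>j\<close>. All four conditions say the same elementary thing: \<open>x y = 0\<close> for all
  \<open>x \<in> P\<^sub>i\<^sub>j\<close>, \<open>y \<in> P\<^sub>j\<^sub>i\<close> and \<open>i \<noteq> j\<close>. Each is compared with this statement separately.

  Condition (1) asks for the maps \<open>\<theta>\<^sub>i\<^sub>j\<^sub>i\<close> to vanish on whole tensor products. Since \<open>\<theta>\<^sub>i\<^sub>j\<^sub>i\<close> is additive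
  and takes \<open>x \<otimes> y\<close> to \<open>x y\<close>, it vanishes exactly when the products do (\<open>in_class_T_iff\<close>).
  Condition (2) speaks of the additive subgroup generated by the elements
  \<open>e\<^sub>i x e\<^sub>j y e\<^sub>i = (e\<^sub>i x e\<^sub>j) (e\<^sub>j y e\<^sub>i)\<close>, which are exactly the products in question
  (\<open>corner_products_zero_iff_triple\<close>).
  For (3), insert \<open>1 = \<Sum>\<^sub>j e\<^sub>j\<close> in the middle: \<open>e\<^sub>i x y e\<^sub>i\<close> is the sum over \<open>j\<close> of \<open>e\<^sub>i x e\<^sub>j y e\<^sub>i\<close>,
  and only the term \<open>j = i\<close> survives when the mixed products vanish. Conversely, inner Peirce
  triviality replaces \<open>x y\<close> by \<open>x e\<^sub>i y\<close>, and \<open>x e\<^sub>i = 0\<close> for \<open>x \<in> P\<^sub>i\<^sub>j\<close>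
  (\<open>inner_peirce_trivial_iff\<close>).
  For (4), the diagonal entry \<open>(i, i)\<close> of \<open>A B\<close> is the sum over \<open>k\<close> of \<open>A\<^sub>i\<^sub>k B\<^sub>k\<^sub>i\<close>. If \<open>A\<close> has zero
  diagonal, only mixed products occur in it; conversely, arrays with a single nonzero entry
  isolate one mixed product (\<open>zero_diagonal_right_ideal_iff\<close>).

  Conditions (1) and (4) also require that the Peirce ring is a generalized matrix ring at all, and
  most of the work goes there. The ring axioms are transported along the isomorphism
  \<open>x \<mapsto> [e\<^sub>i x e\<^sub>j]\<close> (\<open>entries_ring_iso\<close>), which avoids manipulating the double sums of matrix
  associativity. That \<open>\<theta>\<^sub>i\<^sub>j\<^sub>k\<close> is a well-defined homomorphism comes from evaluating formal sums of pairs
  in \<open>R\<close>: this is a homomorphism on the free abelian group that kills the tensor relations.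
\<close>

section \<open>Evaluating formal products\<close>

text \<open>
  A common index set for several formal combinations; over it, additivity can be checked
  coefficient by coefficient.
\<close>

lemma (in ring) mult_eval_superset:
  assumes "finite S" "Poly_Mapping.keys c \<subseteq> S" "S \<subseteq> carrier R \<times> carrier R"
  shows "mult_eval R c = (\<Oplus>p\<in>S. [Poly_Mapping.lookup c p] \<cdot> (fst p \<otimes> snd p))"
  unfolding mult_eval_def
proof (rule add.finprod_mono_neutral_cong_left)
  fix p assume "p \<in> S - Poly_Mapping.keys c"
  then show "[Poly_Mapping.lookup c p] \<cdot> (fst p \<otimes> snd p) = \<zero>"
    by (simp add: in_keys_iff add_pow_def)
qed (use assms in auto)

lemma (in ring) mult_eval_frag_of:
  assumes "x \<in> carrier R" "y \<in> carrier R"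
  shows "mult_eval R (frag_of (x, y)) = x \<otimes> y"
  using mult_eval_superset[of "{(x, y)}" "frag_of (x, y)"] assms by simp

lemma (in ring) mult_eval_add:
  assumes "Poly_Mapping.keys c \<subseteq> carrier R \<times> carrier R" "Poly_Mapping.keys d \<subseteq> carrier R \<times> carrier R"
  shows "mult_eval R (c + d) = mult_eval R c \<oplus> mult_eval R d"
proof -
  let ?S = "Poly_Mapping.keys c \<union> Poly_Mapping.keys d"
  have S: "finite ?S" "?S \<subseteq> carrier R \<times> carrier R"
    using assms by auto
  have "mult_eval R (c + d) =
      (\<Oplus>p\<in>?S. [Poly_Mapping.lookup c p] \<cdot> (fst p \<otimes> snd p) \<oplus> [Poly_Mapping.lookup d p] \<cdot> (fst p \<otimes> snd p))"
    unfolding mult_eval_superset[OF S(1) keys_add S(2)]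
    using S by (intro add.finprod_cong') (auto simp: Poly_Mapping.lookup_add add.int_pow_mult)
  also have "\<dots> = mult_eval R c \<oplus> mult_eval R d"
    using S by (subst add.finprod_multf) (auto simp: mult_eval_superset[OF S(1) _ S(2)])
  finally show ?thesis .
qed

lemma (in ring) mult_eval_group_hom:
  assumes "A \<subseteq> carrier R" "B \<subseteq> carrier R"
  shows "group_hom (free_Abelian_group (A \<times> B)) (add_monoid R) (mult_eval R)"
proof (intro group_hom.intro group_hom_axioms.intro homI)
  fix c d :: "('a \<times> 'a) \<Rightarrow>\<^sub>0 int"
  assume "c \<in> carrier (free_Abelian_group (A \<times> B))"
  then have c: "Poly_Mapping.keys c \<subseteq> carrier R \<times> carrier R"
    using assms by auto
  show "mult_eval R c \<in> carrier (add_monoid R)"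
    unfolding mult_eval_def using c by (auto intro!: add.finprod_closed add.int_pow_closed)
  assume "d \<in> carrier (free_Abelian_group (A \<times> B))"
  then have "Poly_Mapping.keys d \<subseteq> carrier R \<times> carrier R"
    using assms by auto
  with c show "mult_eval R (c \<otimes>\<^bsub>free_Abelian_group (A \<times> B)\<^esub> d) =
      mult_eval R c \<otimes>\<^bsub>add_monoid R\<^esub> mult_eval R d"
    by (simp add: mult_eval_add)
qed (simp_all add: add.group_axioms)

lemma (in ring) mult_eval_diff:
  assumes "Poly_Mapping.keys c \<subseteq> carrier R \<times> carrier R" "Poly_Mapping.keys d \<subseteq> carrier R \<times> carrier R"
  shows "mult_eval R (c - d) = mult_eval R c \<ominus> mult_eval R d"
proof -
  interpret mult_eval_R: group_hom "free_Abelian_group (carrier R \<times> carrier R)" "add_monoid R" "mult_eval R"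
    by (rule mult_eval_group_hom) auto
  show ?thesis
    using mult_eval_R.hom_inv[of d] mult_eval_add[of c "- d"] assms
    by (simp add: a_minus_def a_inv_def)
qed

lemma (in ring) mult_eval_in_subgroup:
  assumes "A \<subseteq> carrier R" "B \<subseteq> carrier R" "subgroup K (add_monoid R)"
    and "\<And>x y. x \<in> A \<Longrightarrow> y \<in> B \<Longrightarrow> x \<otimes> y \<in> K"
    and "Poly_Mapping.keys c \<subseteq> A \<times> B"
  shows "mult_eval R c \<in> K"
  using assms(5)
proof (induction rule: free_Abelian_group_induct[consumes 1, case_names zero diff frag_of])
  case zero
  then show ?case
    using subgroup.one_closed[OF assms(3)] by (simp add: mult_eval_def)
next
  case (diff c d)
  then have "mult_eval R (c - d) = mult_eval R c \<ominus> mult_eval R d"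
    using assms(1,2) by (intro mult_eval_diff) auto
  then show ?case
    using diff subgroup.m_closed[OF assms(3)] subgroup.m_inv_closed[OF assms(3)]
    by (simp add: a_minus_def a_inv_def)
next
  case (frag_of p)
  then show ?case
    using frag_of assms(1,2,4) by (cases p) (auto simp: mult_eval_frag_of subset_iff)
qed

section \<open>Multiplication on tensor products\<close>

text \<open>
  The setting in which multiplication of \<open>R\<close> induces a map on \<open>M \<otimes>\<^sub>S N\<close>: both modules and the
  scalars consist of elements of \<open>R\<close>, and all actions are multiplication in \<open>R\<close>.
\<close>

locale multiplication_tensor = ring R for R :: "('a, 'm) ring_scheme" (structure) +
  fixes S :: "('a, 's) ring_scheme"
    and M :: "('a, 'p) monoid_scheme" and N :: "('a, 'q) monoid_scheme"
  assumes S_carrier: "carrier S \<subseteq> carrier R"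
    and M_carrier: "carrier M \<subseteq> carrier R" and N_carrier: "carrier N \<subseteq> carrier R"
    and M_mult: "monoid.mult M = ring.add R" and N_mult: "monoid.mult N = ring.add R"
    and M_add: "\<And>x y. x \<in> carrier M \<Longrightarrow> y \<in> carrier M \<Longrightarrow> x \<oplus> y \<in> carrier M"
    and N_add: "\<And>x y. x \<in> carrier N \<Longrightarrow> y \<in> carrier N \<Longrightarrow> x \<oplus> y \<in> carrier N"
    and M_act: "\<And>x s. x \<in> carrier M \<Longrightarrow> s \<in> carrier S \<Longrightarrow> x \<otimes> s \<in> carrier M"
    and N_act: "\<And>s y. s \<in> carrier S \<Longrightarrow> y \<in> carrier N \<Longrightarrow> s \<otimes> y \<in> carrier N"
begin

abbreviation "F \<equiv> free_Abelian_group (carrier M \<times> carrier N)"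
abbreviation "T \<equiv> tensor_subgroup S M (monoid.mult R) N (monoid.mult R)"

sublocale mult_eval_F: group_hom F "add_monoid R" "mult_eval R"
  using M_carrier N_carrier by (rule mult_eval_group_hom)

lemma in_F_imp: "c \<in> carrier F \<Longrightarrow> Poly_Mapping.keys c \<subseteq> carrier R \<times> carrier R"
  using M_carrier N_carrier by auto

lemma diff_in_F: "c \<in> carrier F \<Longrightarrow> d \<in> carrier F \<Longrightarrow> c - d \<in> carrier F"
  using keys_diff[of c d] by auto

lemma mult_eval_diff_F:
  "c \<in> carrier F \<Longrightarrow> d \<in> carrier F \<Longrightarrow> mult_eval R (c - d) = mult_eval R c \<ominus> mult_eval R d"
  by (intro mult_eval_diff in_F_imp)

text \<open>
  The three kinds of relations are sent to \<open>0\<close> by the two distributive laws and by associativity of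
  \<open>R\<close>, respectively.
\<close>

lemma tensor_relations_in_kernel:
  "tensor_relations S M (monoid.mult R) N (monoid.mult R) \<subseteq> kernel F (add_monoid R) (mult_eval R)"
proof -
  have frag: "frag_of (x, y) \<in> carrier F" "mult_eval R (frag_of (x, y)) = x \<otimes> y"
    if "x \<in> carrier M" "y \<in> carrier N" for x y
    using that M_carrier N_carrier by (auto simp: mult_eval_frag_of subset_iff)
  have MR: "x \<in> carrier R" if "x \<in> carrier M" for x using that M_carrier by auto
  have NR: "x \<in> carrier R" if "x \<in> carrier N" for x using that N_carrier by auto
  have SR: "x \<in> carrier R" if "x \<in> carrier S" for x using that S_carrier by auto
  have self: "a \<ominus> a = \<zero>" if "a \<in> carrier R" for a
    using that by (simp add: a_minus_def r_neg)
  have cancel: "a \<oplus> b \<ominus> a \<ominus> b = \<zero>" if "a \<in> carrier R" "b \<in> carrier R" for a b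
  proof -
    have "a \<oplus> b \<ominus> a \<ominus> b = (a \<oplus> b) \<oplus> \<ominus> (a \<oplus> b)"
      using that by (simp add: a_minus_def minus_add a_assoc)
    then show ?thesis
      using that by (simp add: r_neg)
  qed
  show ?thesis
    unfolding tensor_relations_def kernel_def
    by (auto simp: frag diff_in_F mult_eval_diff_F M_mult N_mult M_add N_add M_act N_act MR NR SR
        l_distr r_distr m_assoc cancel self
        simp del: carrier_free_Abelian_group_iff)
qed

lemma T_subgroup: "subgroup T F"
  using tensor_relations_in_kernel unfolding tensor_subgroup_def
  by (intro mult_eval_F.generate_is_subgroup) (auto simp: kernel_def)

lemma T_normal: "T \<lhd> F"
  by (rule comm_group.subgroup_imp_normal[OF abelian_free_Abelian_group T_subgroup])

lemma T_kernel: "t \<in> T \<Longrightarrow> t \<in> carrier F \<and> mult_eval R t = \<zero>"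
  using mult_eval_F.generate_subgroup_incl[OF tensor_relations_in_kernel mult_eval_F.subgroup_kernel]
  unfolding tensor_subgroup_def kernel_def by auto

text \<open>
  As \<open>mult_eval R\<close> vanishes on \<open>T\<close>, its image of a coset is a singleton, whose only element is what
  \<open>peirce_theta\<close> picks.
\<close>

lemma peirce_theta_coset:
  assumes "c \<in> carrier F"
  shows "peirce_theta R (T #>\<^bsub>F\<^esub> c) = mult_eval R c"
proof -
  have "mult_eval R (t + c) = mult_eval R c" if "t \<in> T" for t
    using T_kernel[OF that] assms mult_eval_F.hom_mult[of t c] mult_eval_F.hom_closed[of c]
    by (simp del: carrier_free_Abelian_group_iff)
  moreover have "0 \<in> T"
    using subgroup.one_closed[OF T_subgroup] by simp
  ultimately have "mult_eval R ` (T #>\<^bsub>F\<^esub> c) = {mult_eval R c}"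
    by (auto simp: r_coset_def)
  then show ?thesis
    by (simp add: peirce_theta_def)
qed

lemma peirce_theta_pure:
  assumes "x \<in> carrier M" "y \<in> carrier N"
  shows "peirce_theta R (pure_tensor S M (monoid.mult R) N (monoid.mult R) x y) = x \<otimes> y"
  using assms M_carrier N_carrier
  by (auto simp: pure_tensor_def peirce_theta_coset mult_eval_frag_of subset_iff)

lemma pure_tensor_closed:
  assumes "x \<in> carrier M" "y \<in> carrier N"
  shows "pure_tensor S M (monoid.mult R) N (monoid.mult R) x y
    \<in> carrier (tensor_product S M (monoid.mult R) N (monoid.mult R))"
  using assms unfolding pure_tensor_def tensor_product_def FactGroup_def RCOSETS_def by auto

lemma tensor_cases:
  assumes "t \<in> carrier (tensor_product S M (monoid.mult R) N (monoid.mult R))"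
  obtains c where "c \<in> carrier F" "t = T #>\<^bsub>F\<^esub> c"
  using assms unfolding tensor_product_def FactGroup_def RCOSETS_def by auto

text \<open>
  With \<open>K\<close> a Peirce corner this gives the codomain of \<open>\<theta>\<^sub>i\<^sub>j\<^sub>k\<close>; with \<open>K = {0}\<close> it says that the map
  vanishes as soon as all products do.
\<close>

lemma peirce_theta_in_subgroup:
  assumes "subgroup K (add_monoid R)"
    and "\<And>x y. x \<in> carrier M \<Longrightarrow> y \<in> carrier N \<Longrightarrow> x \<otimes> y \<in> K"
    and "t \<in> carrier (tensor_product S M (monoid.mult R) N (monoid.mult R))"
  shows "peirce_theta R t \<in> K"
proof -
  obtain c where "c \<in> carrier F" "t = T #>\<^bsub>F\<^esub> c"
    using assms(3) by (rule tensor_cases)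
  then show ?thesis
    using mult_eval_in_subgroup[OF M_carrier N_carrier assms(1,2)] by (simp add: peirce_theta_coset)
qed

lemma peirce_theta_mult:
  assumes "s \<in> carrier (tensor_product S M (monoid.mult R) N (monoid.mult R))"
    and "t \<in> carrier (tensor_product S M (monoid.mult R) N (monoid.mult R))"
  shows "peirce_theta R (s \<otimes>\<^bsub>tensor_product S M (monoid.mult R) N (monoid.mult R)\<^esub> t) =
    peirce_theta R s \<oplus> peirce_theta R t"
proof -
  obtain c d where c: "c \<in> carrier F" "s = T #>\<^bsub>F\<^esub> c" and d: "d \<in> carrier F" "t = T #>\<^bsub>F\<^esub> d"
    using tensor_cases[OF assms(1)] tensor_cases[OF assms(2)] by metis
  have "s \<otimes>\<^bsub>tensor_product S M (monoid.mult R) N (monoid.mult R)\<^esub> t = T #>\<^bsub>F\<^esub> (c \<otimes>\<^bsub>F\<^esub> d)"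
    using normal.rcos_sum[OF T_normal c(1) d(1)] c(2) d(2)
    by (simp add: tensor_product_def FactGroup_def)
  then show ?thesis
    using c d mult_eval_F.hom_mult[of c d] peirce_theta_coset[of "c \<otimes>\<^bsub>F\<^esub> d"]
      mult_eval_F.G.m_closed[of c d]
    by (simp add: peirce_theta_coset del: carrier_free_Abelian_group_iff)
qed

end

section \<open>Peirce corners\<close>

text \<open>
  For idempotents, a corner is the set of elements fixed by both multiplications. In this form,
  membership is decided by rewriting instead of by exhibiting witnesses.
\<close>

lemma (in ring) peirce_part_iff:
  assumes "e \<in> carrier R" "e \<otimes> e = e" "f \<in> carrier R" "f \<otimes> f = f"
  shows "x \<in> peirce_part R e f \<longleftrightarrow> x \<in> carrier R \<and> e \<otimes> x = x \<and> x \<otimes> f = x"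
proof
  assume "x \<in> peirce_part R e f"
  then obtain y where y: "y \<in> carrier R" "x = e \<otimes> y \<otimes> f"
    by (auto simp: peirce_part_def)
  have "e \<otimes> x = (e \<otimes> e) \<otimes> y \<otimes> f" "x \<otimes> f = e \<otimes> y \<otimes> (f \<otimes> f)"
    using y assms(1,3) by (simp_all add: m_assoc)
  then show "x \<in> carrier R \<and> e \<otimes> x = x \<and> x \<otimes> f = x"
    using y assms by simp
next
  assume "x \<in> carrier R \<and> e \<otimes> x = x \<and> x \<otimes> f = x"
  then show "x \<in> peirce_part R e f"
    by (auto simp: peirce_part_def intro!: exI[of _ x])
qed

lemma (in ring) peirce_part_subgroup:
  assumes "e \<in> carrier R" "f \<in> carrier R"
  shows "subgroup (peirce_part R e f) (add_monoid R)"
proof (rule add.subgroupI)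
  show "peirce_part R e f \<subseteq> carrier R" "peirce_part R e f \<noteq> {}"
    using assms by (auto simp: peirce_part_def)
next
  fix x assume "x \<in> peirce_part R e f"
  then obtain x' where x: "x' \<in> carrier R" "x = e \<otimes> x' \<otimes> f"
    by (auto simp: peirce_part_def)
  then have "\<ominus> x = e \<otimes> (\<ominus> x') \<otimes> f"
    using assms by (simp add: l_minus r_minus)
  then show "\<ominus> x \<in> peirce_part R e f"
    using x by (auto simp: peirce_part_def)
  fix y assume "y \<in> peirce_part R e f"
  then obtain y' where y: "y' \<in> carrier R" "y = e \<otimes> y' \<otimes> f"
    by (auto simp: peirce_part_def)
  then have "x \<oplus> y = e \<otimes> (x' \<oplus> y') \<otimes> f"
    using assms x by (simp add: l_distr r_distr)
  then show "x \<oplus> y \<in> peirce_part R e f"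
    using x y by (auto simp: peirce_part_def)
qed

lemma (in ring) peirce_part_mult:
  assumes "e \<in> carrier R" "f \<in> carrier R" "g \<in> carrier R" "x \<in> peirce_part R e f" "y \<in> peirce_part R f g"
  shows "x \<otimes> y \<in> peirce_part R e g"
proof -
  obtain x' y' where "x' \<in> carrier R" "x = e \<otimes> x' \<otimes> f" "y' \<in> carrier R" "y = f \<otimes> y' \<otimes> g"
    using assms(4,5) by (auto simp: peirce_part_def)
  then show ?thesis
    using assms(1-3) by (auto simp: peirce_part_def m_assoc intro!: exI[of _ "x' \<otimes> (f \<otimes> (f \<otimes> y'))"])
qed

abbreviation subgroup_monoid :: "('a, 'm) ring_scheme \<Rightarrow> 'a set \<Rightarrow> 'a monoid" where
  "subgroup_monoid R K \<equiv> \<lparr>carrier = K, monoid.mult = ring.add R, one = \<zero>\<^bsub>R\<^esub>\<rparr>"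

lemma (in ring) comm_group_subgroup_monoid:
  assumes "subgroup K (add_monoid R)"
  shows "comm_group (subgroup_monoid R K)"
proof -
  interpret K: subgroup K "add_monoid R" by fact
  have K: "x \<in> carrier R" if "x \<in> K" for x using K.subset that by auto
  have "\<exists>y\<in>K. y \<oplus> x = \<zero>" if "x \<in> K" for x
    using that K.m_inv_closed K by (intro bexI[of _ "\<ominus> x"]) (auto simp: a_inv_def[symmetric] l_neg)
  then show ?thesis
    using K.m_closed K.one_closed by (intro comm_groupI) (auto simp: K a_ac)
qed

text \<open>
  The product of two arrays in a generalized matrix ring is a sum formed in the module of the
  \<open>(i, j)\<close>-entry, the one in the Peirce ring a sum formed in \<open>R\<close>; this identifies the two.
\<close>

lemma (in ring) finprod_subgroup_monoid:
  assumes "subgroup K (add_monoid R)" "finite A" "f \<in> A \<rightarrow> K"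
  shows "finprod (subgroup_monoid R K) f A = finsum R f A"
proof -
  interpret K: comm_group "subgroup_monoid R K"
    using assms(1) by (rule comm_group_subgroup_monoid)
  have K: "K \<subseteq> carrier R"
    using subgroup.subset[OF assms(1)] by simp
  from assms(2,3) show ?thesis
  proof (induction rule: finite_induct)
    case (insert a A)
    then have "f a \<in> K" "f \<in> A \<rightarrow> K" "f a \<in> carrier R" "f \<in> A \<rightarrow> carrier R"
      using K by auto
    with insert show ?case by simp
  qed simp
qed

lemma (in ring) peirce_diag_ring_ring:
  assumes "e \<in> carrier R" "e \<otimes> e = e"
  shows "ring (peirce_diag_ring R e)"
proof -
  note P = peirce_part_iff[OF assms assms]
  have inv: "\<exists>y\<in>peirce_part R e e. y \<oplus> x = \<zero>" if "x \<in> peirce_part R e e" for x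
    using that P[of "\<ominus> x"] P[of x] assms by (intro bexI[of _ "\<ominus> x"]) (auto simp: l_neg l_minus r_minus)
  have absorb: "e \<otimes> (x \<otimes> y) = x \<otimes> y" if "x \<in> carrier R" "y \<in> carrier R" "e \<otimes> x = x" for x y
    using that assms m_assoc[of e x y] by simp
  show ?thesis
    using assms inv absorb
    by (intro ringI abelian_groupI monoidI)
       (auto simp: peirce_diag_ring_def P l_distr r_distr a_ac m_assoc)
qed

lemma (in ring) peirce_bimodule:
  assumes "e \<in> carrier R" "e \<otimes> e = e" "f \<in> carrier R" "f \<otimes> f = f"
  shows "bimodule (peirce_diag_ring R e) (peirce_diag_ring R f)
    (subgroup_monoid R (peirce_part R e f)) (monoid.mult R) (monoid.mult R)"
proof -
  note P = peirce_part_iff[OF assms] peirce_part_iff[OF assms(1,2) assms(1,2)]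
    peirce_part_iff[OF assms(3,4) assms(3,4)]
  show ?thesis
    unfolding bimodule_def hom_def
    using assms peirce_diag_ring_ring[OF assms(1,2)] peirce_diag_ring_ring[OF assms(3,4)]
      comm_group_subgroup_monoid[OF peirce_part_subgroup[OF assms(1,3)]]
    by (auto simp: peirce_diag_ring_def P l_distr r_distr m_assoc)
       (metis m_assoc)+
qed

lemma (in ring) peirce_multiplication_tensor:
  assumes "e \<in> carrier R" "f \<in> carrier R" "g \<in> carrier R"
  shows "multiplication_tensor R (peirce_diag_ring R f)
    (subgroup_monoid R (peirce_part R e f)) (subgroup_monoid R (peirce_part R f g))"
proof -
  have "peirce_part R a b \<subseteq> carrier R" if "a \<in> carrier R" "b \<in> carrier R" for a b
    using that by (auto simp: peirce_part_def)
  moreover have "x \<oplus> y \<in> peirce_part R a b"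
    if "x \<in> peirce_part R a b" "y \<in> peirce_part R a b" "a \<in> carrier R" "b \<in> carrier R" for a b x y
    using subgroup.m_closed[OF peirce_part_subgroup[OF that(3,4)]] that by simp
  ultimately show ?thesis
    using assms peirce_part_mult
    by unfold_locales (auto simp: peirce_diag_ring_def)
qed


section \<open>The Peirce ring\<close>

locale peirce_decomposition = ring R for R :: "('a, 'm) ring_scheme" (structure) +
  fixes n :: nat and e :: "nat \<Rightarrow> 'a"
  assumes complete: "complete_orthogonal_idempotents R n e"
begin

abbreviation "I \<equiv> {1..n}"
abbreviation "P i j \<equiv> peirce_part R (e i) (e j)"
abbreviation "G \<equiv> peirce_ring R n e"

\<comment> \<open>Keeps the index set in the form \<open>{1..n}\<close>, so that facts about it stay applicable.\<close>
declare One_nat_def [simp del]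

lemma e_closed [simp]: "i \<in> I \<Longrightarrow> e i \<in> carrier R"
  and e_idem [simp]: "i \<in> I \<Longrightarrow> e i \<otimes> e i = e i"
  and e_orth: "i \<in> I \<Longrightarrow> j \<in> I \<Longrightarrow> i \<noteq> j \<Longrightarrow> e i \<otimes> e j = \<zero>"
  and e_sum: "(\<Oplus>i\<in>I. e i) = \<one>"
  using complete by (auto simp: complete_orthogonal_idempotents_def)

lemma P_iff: "i \<in> I \<Longrightarrow> j \<in> I \<Longrightarrow> x \<in> P i j \<longleftrightarrow> x \<in> carrier R \<and> e i \<otimes> x = x \<and> x \<otimes> e j = x"
  by (rule peirce_part_iff) auto

lemma P_carrier: "i \<in> I \<Longrightarrow> j \<in> I \<Longrightarrow> x \<in> P i j \<Longrightarrow> x \<in> carrier R"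
  by (simp add: P_iff)

lemma P_mult: "i \<in> I \<Longrightarrow> j \<in> I \<Longrightarrow> k \<in> I \<Longrightarrow> x \<in> P i j \<Longrightarrow> y \<in> P j k \<Longrightarrow> x \<otimes> y \<in> P i k"
  by (rule peirce_part_mult[of "e i" "e j" "e k"]) auto

lemma P_subgroup: "i \<in> I \<Longrightarrow> j \<in> I \<Longrightarrow> subgroup (P i j) (add_monoid R)"
  by (rule peirce_part_subgroup) auto

lemma P_zero: "i \<in> I \<Longrightarrow> j \<in> I \<Longrightarrow> \<zero> \<in> P i j"
  by (simp add: P_iff)

lemma e_mult_P: "k \<in> I \<Longrightarrow> i \<in> I \<Longrightarrow> j \<in> I \<Longrightarrow> x \<in> P i j \<Longrightarrow> e k \<otimes> x = (if k = i then x else \<zero>)"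
  and P_mult_e: "k \<in> I \<Longrightarrow> i \<in> I \<Longrightarrow> j \<in> I \<Longrightarrow> x \<in> P i j \<Longrightarrow> x \<otimes> e k = (if j = k then x else \<zero>)"
proof -
  assume I: "k \<in> I" "i \<in> I" "j \<in> I" and "x \<in> P i j"
  then have x: "x \<in> carrier R" "e i \<otimes> x = x" "x \<otimes> e j = x"
    by (auto simp: P_iff)
  show "e k \<otimes> x = (if k = i then x else \<zero>)"
  proof (cases "k = i")
    case False
    have "e k \<otimes> x = e k \<otimes> e i \<otimes> x"
      using x I by (simp add: m_assoc)
    with False x I show ?thesis by (simp add: e_orth)
  qed (use x in simp)
  show "x \<otimes> e k = (if j = k then x else \<zero>)"
  proof (cases "j = k")
    case False
    have "x \<otimes> e k = x \<otimes> (e j \<otimes> e k)"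
      using x I by (simp add: m_assoc[symmetric])
    with False x I show ?thesis by (simp add: e_orth)
  qed (use x in simp)
qed

text \<open>
  Inserting \<open>1 = \<Sum>\<^sub>k e\<^sub>k\<close> between two factors turns a product in \<open>R\<close> into a row-column product.
\<close>

lemma mult_expand:
  assumes "x \<in> carrier R" "y \<in> carrier R"
  shows "x \<otimes> y = (\<Oplus>k\<in>I. x \<otimes> e k \<otimes> y)"
proof -
  have "x \<otimes> y = x \<otimes> (\<Oplus>k\<in>I. e k) \<otimes> y"
    using assms by (simp add: e_sum)
  also have "\<dots> = (\<Oplus>k\<in>I. x \<otimes> e k \<otimes> y)"
    using assms by (subst finsum_rdistr, simp, simp, force, subst finsum_ldistr) auto
  finally show ?thesis .
qed

definition entries :: "'a \<Rightarrow> nat \<Rightarrow> nat \<Rightarrow> 'a" where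
  "entries x = (\<lambda>i\<in>I. \<lambda>j\<in>I. e i \<otimes> x \<otimes> e j)"

lemma sum_entries:
  assumes "x \<in> carrier R"
  shows "x = (\<Oplus>i\<in>I. \<Oplus>j\<in>I. entries x i j)"
proof -
  have "x = (\<Oplus>i\<in>I. e i \<otimes> x)"
    using mult_expand[of \<one> x] assms by (simp cong: finsum_cong)
  also have "\<dots> = (\<Oplus>i\<in>I. \<Oplus>j\<in>I. entries x i j)"
  proof (rule add.finprod_cong')
    fix i assume i: "i \<in> I"
    have "e i \<otimes> x = (\<Oplus>j\<in>I. e i \<otimes> x \<otimes> e j \<otimes> \<one>)"
      using mult_expand[of "e i \<otimes> x" \<one>] i assms by simp
    also have "\<dots> = (\<Oplus>j\<in>I. entries x i j)"
      using i assms by (intro add.finprod_cong') (auto simp: entries_def)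
    finally show "e i \<otimes> x = (\<Oplus>j\<in>I. entries x i j)" .
  qed (use assms in \<open>auto simp: entries_def intro!: finsum_closed\<close>)
  finally show ?thesis .
qed

text \<open>
  In \<open>e\<^sub>k (\<Sum>\<^sub>i\<^sub>j A\<^sub>i\<^sub>j) e\<^sub>l\<close>, orthogonality removes first all rows but \<open>k\<close>, then all columns but \<open>l\<close>.
  So summing all entries inverts the passage from elements to arrays.
\<close>

lemma entries_sum:
  assumes "A \<in> carrier G"
  shows "entries (\<Oplus>i\<in>I. \<Oplus>j\<in>I. A i j) = A"
proof -
  have A: "A i j \<in> P i j" "A i j \<in> carrier R" if "i \<in> I" "j \<in> I" for i j
    using assms that P_carrier by (auto simp: peirce_ring_def PiE_iff)
  have row: "(\<Oplus>j\<in>I. A i j) \<in> carrier R" if "i \<in> I" for i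
    using A that by (auto intro!: finsum_closed)
  have entry: "e k \<otimes> (\<Oplus>i\<in>I. \<Oplus>j\<in>I. A i j) \<otimes> e l = A k l" if k: "k \<in> I" and l: "l \<in> I" for k l
  proof -
    have "e k \<otimes> (\<Oplus>j\<in>I. A i j) = (if k = i then (\<Oplus>j\<in>I. A i j) else \<zero>)" if i: "i \<in> I" for i
    proof -
      have "e k \<otimes> (\<Oplus>j\<in>I. A i j) = (\<Oplus>j\<in>I. e k \<otimes> A i j)"
        using k i A by (intro finsum_rdistr) auto
      also have "\<dots> = (\<Oplus>j\<in>I. if k = i then A i j else \<zero>)"
        using k i A by (intro add.finprod_cong') (auto simp: e_mult_P)
      finally show ?thesis by simp
    qed
    then have "(\<Oplus>i\<in>I. e k \<otimes> (\<Oplus>j\<in>I. A i j)) = (\<Oplus>i\<in>I. if k = i then (\<Oplus>j\<in>I. A i j) else \<zero>)"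
      using row by (intro add.finprod_cong') auto
    moreover have "e k \<otimes> (\<Oplus>i\<in>I. \<Oplus>j\<in>I. A i j) = (\<Oplus>i\<in>I. e k \<otimes> (\<Oplus>j\<in>I. A i j))"
      using k row by (intro finsum_rdistr) auto
    ultimately have "e k \<otimes> (\<Oplus>i\<in>I. \<Oplus>j\<in>I. A i j) = (\<Oplus>j\<in>I. A k j)"
      using k row finsum_singleton[of k I "\<lambda>i. \<Oplus>j\<in>I. A i j"] by auto
    moreover have "(\<Oplus>j\<in>I. A k j) \<otimes> e l = (\<Oplus>j\<in>I. A k j \<otimes> e l)"
      using k l A by (intro finsum_ldistr) auto
    moreover have "\<dots> = (\<Oplus>j\<in>I. if l = j then A k j else \<zero>)"
      using k l A by (intro add.finprod_cong') (auto simp: P_mult_e)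
    moreover have "\<dots> = A k l"
      using k l A by (intro finsum_singleton) auto
    ultimately show ?thesis by simp
  qed
  show ?thesis
  proof (rule ext, rule ext)
    fix i j
    show "entries (\<Oplus>i\<in>I. \<Oplus>j\<in>I. A i j) i j = A i j"
      using assms entry
      by (auto simp: entries_def restrict_def peirce_ring_def PiE_iff extensional_def)
  qed
qed

lemma entries_closed: "x \<in> carrier R \<Longrightarrow> entries x \<in> carrier G"
  unfolding entries_def peirce_ring_def by simp (fastforce simp: peirce_part_def)

lemma entries_ring_iso: "entries \<in> ring_iso R G"
proof (rule ring_iso_memI)
  show "bij_betw entries (carrier R) (carrier G)"
  proof (rule bij_betwI[where g = "\<lambda>A. \<Oplus>i\<in>I. \<Oplus>j\<in>I. A i j"])
    show "entries \<in> carrier R \<rightarrow> carrier G"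
      using entries_closed by auto
    show "(\<lambda>A. \<Oplus>i\<in>I. \<Oplus>j\<in>I. A i j) \<in> carrier G \<rightarrow> carrier R"
      using P_carrier by (auto simp: peirce_ring_def PiE_iff intro!: finsum_closed)
  qed (simp_all add: sum_entries[symmetric] entries_sum)
next
  fix x assume x: "x \<in> carrier R"
  then show "entries x \<in> carrier G" by (rule entries_closed)
  fix y assume y: "y \<in> carrier R"
  show "entries (x \<oplus> y) = entries x \<oplus>\<^bsub>G\<^esub> entries y"
    using x y by (auto simp: entries_def peirce_ring_def l_distr r_distr fun_eq_iff restrict_def)
  have "e i \<otimes> (x \<otimes> y) \<otimes> e j = (\<Oplus>k\<in>I. (e i \<otimes> x \<otimes> e k) \<otimes> (e k \<otimes> y \<otimes> e j))"
    if i: "i \<in> I" and j: "j \<in> I" for i j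
  proof -
    have "e i \<otimes> (x \<otimes> y) \<otimes> e j = (e i \<otimes> x) \<otimes> (y \<otimes> e j)"
      using x y i j by (simp add: m_assoc)
    also have "\<dots> = (\<Oplus>k\<in>I. (e i \<otimes> x) \<otimes> e k \<otimes> (y \<otimes> e j))"
      using x y i j by (intro mult_expand) auto
    also have "\<dots> = (\<Oplus>k\<in>I. (e i \<otimes> x \<otimes> e k) \<otimes> (e k \<otimes> y \<otimes> e j))"
    proof (rule add.finprod_cong')
      fix k assume k: "k \<in> I"
      have "(e i \<otimes> x) \<otimes> e k \<otimes> (y \<otimes> e j) = (e i \<otimes> x) \<otimes> (e k \<otimes> e k) \<otimes> (y \<otimes> e j)"
        using k by simp
      also have "\<dots> = (e i \<otimes> x \<otimes> e k) \<otimes> (e k \<otimes> y \<otimes> e j)"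
        using x y i j k by (simp add: m_assoc del: e_idem)
      finally show "(e i \<otimes> x) \<otimes> e k \<otimes> (y \<otimes> e j) = (e i \<otimes> x \<otimes> e k) \<otimes> (e k \<otimes> y \<otimes> e j)" .
    qed (use x y i j in auto)
    finally show ?thesis .
  qed
  then show "entries (x \<otimes> y) = entries x \<otimes>\<^bsub>G\<^esub> entries y"
    using x y by (auto simp: entries_def peirce_ring_def intro!: restrict_ext add.finprod_cong')
next
  show "entries \<one> = \<one>\<^bsub>G\<^esub>"
    using e_orth by (auto simp: entries_def peirce_ring_def fun_eq_iff restrict_def)
qed

lemma ring_G: "ring G"
proof -
  have "entries \<zero> = \<zero>\<^bsub>G\<^esub>"
    by (auto simp: entries_def peirce_ring_def fun_eq_iff restrict_def)
  moreover have "ring (G\<lparr>zero := entries \<zero>\<rparr>)"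
    using entries_ring_iso by (rule ring_iso_imp_img_ring)
  ultimately show ?thesis by simp
qed


lemma G_simps:
  "carrier G = (\<Pi>\<^sub>E i\<in>I. \<Pi>\<^sub>E j\<in>I. P i j)"
  "monoid.mult G = (\<lambda>A B. \<lambda>i\<in>I. \<lambda>j\<in>I. \<Oplus>k\<in>I. A i k \<otimes> B k j)"
  "ring.add G = (\<lambda>A B. \<lambda>i\<in>I. \<lambda>j\<in>I. A i j \<oplus> B i j)"
  "ring.zero G = (\<lambda>i\<in>I. \<lambda>j\<in>I. \<zero>)"
  "diag_ring G i = peirce_diag_ring R (e i)"
  "bim G i j = subgroup_monoid R (P i j)"
  "lact G i j = monoid.mult R"
  "ract G i j = monoid.mult R"
  "theta G i j k = peirce_theta R"
  by (simp_all add: peirce_ring_def)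

lemma carrier_peirce_diag_ring: "carrier (peirce_diag_ring R a) = peirce_part R a a"
  by (simp add: peirce_diag_ring_def)

lemma corner_tensor:
  assumes "i \<in> I" "j \<in> I" "k \<in> I"
  shows "multiplication_tensor R (peirce_diag_ring R (e j)) (subgroup_monoid R (P i j)) (subgroup_monoid R (P j k))"
  using assms by (intro peirce_multiplication_tensor) auto

lemma theta_pure:
  assumes "i \<in> I" "j \<in> I" "k \<in> I" "x \<in> P i j" "y \<in> P j k"
  shows "theta G i j k (gmr_pure G i j k x y) = x \<otimes> y"
  using multiplication_tensor.peirce_theta_pure[OF corner_tensor[OF assms(1-3)]] assms
  by (simp add: G_simps gmr_pure_def)

lemma theta_in_subgroup:
  assumes "i \<in> I" "j \<in> I" "k \<in> I" "subgroup K (add_monoid R)"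
    and "\<And>x y. x \<in> P i j \<Longrightarrow> y \<in> P j k \<Longrightarrow> x \<otimes> y \<in> K"
    and "t \<in> carrier (gmr_tensor G i j k)"
  shows "theta G i j k t \<in> K"
  using multiplication_tensor.peirce_theta_in_subgroup[OF corner_tensor[OF assms(1-3)] assms(4)] assms(5,6)
  by (simp add: G_simps gmr_tensor_def)

lemma theta_hom:
  assumes "i \<in> I" "j \<in> I" "k \<in> I"
  shows "theta G i j k \<in> hom (gmr_tensor G i j k) (bim G i k)"
proof (rule homI)
  fix s t assume s: "s \<in> carrier (gmr_tensor G i j k)"
  show "theta G i j k s \<in> carrier (bim G i k)"
    using theta_in_subgroup[OF assms P_subgroup[OF assms(1,3)] P_mult[OF assms] s]
    by (simp add: G_simps)
  assume "t \<in> carrier (gmr_tensor G i j k)"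
  with s show "theta G i j k (s \<otimes>\<^bsub>gmr_tensor G i j k\<^esub> t) =
      theta G i j k s \<otimes>\<^bsub>bim G i k\<^esub> theta G i j k t"
    using multiplication_tensor.peirce_theta_mult[OF corner_tensor[OF assms]]
    by (simp add: G_simps gmr_tensor_def)
qed

lemma pure_closed:
  assumes "i \<in> I" "j \<in> I" "k \<in> I" "x \<in> P i j" "y \<in> P j k"
  shows "gmr_pure G i j k x y \<in> carrier (gmr_tensor G i j k)"
  using multiplication_tensor.pure_tensor_closed[OF corner_tensor[OF assms(1-3)]] assms
  by (simp add: G_simps gmr_pure_def gmr_tensor_def)

text \<open>
  Once \<open>\<theta>\<^sub>i\<^sub>j\<^sub>k (x \<otimes> y) = x y\<close> is known, compatibility of \<open>\<theta>\<^sub>i\<^sub>j\<^sub>k\<close> with the outer actions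
  is associativity in \<open>R\<close>, and the multiplication of arrays is the row-column product.
\<close>

lemma generalized_matrix_ring_G: "generalized_matrix_ring n G"
proof -
  have mult: "(A \<otimes>\<^bsub>G\<^esub> B) i j =
      finprod (bim G i j) (\<lambda>k. theta G i k j (gmr_pure G i k j (A i k) (B k j))) I"
    if AB: "A \<in> carrier G" "B \<in> carrier G" and ij: "i \<in> I" "j \<in> I" for A B i j
  proof -
    have P: "A i k \<in> P i k" "B k j \<in> P k j" if "k \<in> I" for k
      using AB ij that by (auto simp: G_simps PiE_iff)
    have "(\<lambda>k. theta G i k j (gmr_pure G i k j (A i k) (B k j))) \<in> I \<rightarrow> P i j"
      using ij P P_mult by (auto simp: theta_pure)
    then have "finprod (bim G i j) (\<lambda>k. theta G i k j (gmr_pure G i k j (A i k) (B k j))) I =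
        (\<Oplus>k\<in>I. theta G i k j (gmr_pure G i k j (A i k) (B k j)))"
      unfolding G_simps(6) using P_subgroup[OF ij] by (intro finprod_subgroup_monoid) auto
    also have "\<dots> = (\<Oplus>k\<in>I. A i k \<otimes> B k j)"
      using ij P P_carrier[OF ij P_mult[OF ij(1) _ ij(2)]]
      by (intro add.finprod_cong') (auto simp: theta_pure)
    finally show ?thesis
      using ij by (simp add: G_simps)
  qed
  have bimod: "bimodule (diag_ring G i) (diag_ring G j) (bim G i j) (lact G i j) (ract G i j)"
    if "i \<in> I" "j \<in> I" for i j
    unfolding G_simps using that by (intro peirce_bimodule) auto
  show ?thesis
    unfolding generalized_matrix_ring_def
  proof (intro conjI ballI)
    show "ring G" by (rule ring_G)
    show "carrier G = (\<Pi>\<^sub>E i\<in>I. \<Pi>\<^sub>E j\<in>I. carrier (bim G i j))"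
      by (simp add: G_simps)
  next
    fix i x y assume "i \<in> I" "x \<in> carrier (diag_ring G i)" "y \<in> carrier (diag_ring G i)"
    show "lact G i i x y = x \<otimes>\<^bsub>diag_ring G i\<^esub> y" "ract G i i x y = x \<otimes>\<^bsub>diag_ring G i\<^esub> y"
      by (simp_all add: G_simps peirce_diag_ring_def)
  next
    fix A B i j assume "i \<in> I" "j \<in> I"
    then show "(A \<oplus>\<^bsub>G\<^esub> B) i j = A i j \<otimes>\<^bsub>bim G i j\<^esub> B i j"
      by (simp add: G_simps)
  next
    fix i show "bim G i i = add_monoid (diag_ring G i)"
      by (simp add: G_simps peirce_diag_ring_def)
  next
    fix i j k assume I: "i \<in> I" "j \<in> I" "k \<in> I"
    then show "theta G i j k \<in> hom (gmr_tensor G i j k) (bim G i k)"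
      by (rule theta_hom)
    fix x y assume "x \<in> carrier (bim G i j)" "y \<in> carrier (bim G j k)"
    then have x: "x \<in> P i j" and y: "y \<in> P j k"
      by (auto simp: G_simps)
    note xy = x y P_carrier[OF I(1,2) x] P_carrier[OF I(2,3) y]
    {
      fix a assume "a \<in> carrier (diag_ring G i)"
      then have a: "a \<in> P i i"
        by (simp add: G_simps carrier_peirce_diag_ring)
      show "theta G i j k (gmr_pure G i j k (lact G i j a x) y) =
          lact G i k a (theta G i j k (gmr_pure G i j k x y))"
        using I xy a P_carrier[OF I(1,1) a] P_mult[OF I(1,1,2) a x]
        by (simp add: theta_pure G_simps(7) m_assoc)
    next
      fix b assume "b \<in> carrier (diag_ring G k)"
      then have b: "b \<in> P k k"
        by (simp add: G_simps carrier_peirce_diag_ring)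
      show "theta G i j k (gmr_pure G i j k x (ract G j k y b)) =
          ract G i k (theta G i j k (gmr_pure G i j k x y)) b"
        using I xy b P_carrier[OF I(3,3) b] P_mult[OF I(2,3,3) y b]
        by (simp add: theta_pure G_simps(8) m_assoc)
    }
  next
    fix i j x assume ij: "i \<in> I" "j \<in> I" and x: "x \<in> carrier (bim G i j)"
    show "theta G i i j (gmr_pure G i i j a x) = lact G i j a x" if "a \<in> carrier (diag_ring G i)" for a
      using ij x that by (simp add: theta_pure carrier_peirce_diag_ring G_simps(5-8))
    show "theta G i j j (gmr_pure G i j j x b) = ract G i j x b" if "b \<in> carrier (diag_ring G j)" for b
      using ij x that by (simp add: theta_pure carrier_peirce_diag_ring G_simps(5-8))
  qed (simp_all only: mult bimod)
qed

section \<open>The four conditions\<close>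

text \<open>
  Pure tensors test the vanishing of \<open>\<theta>\<^sub>i\<^sub>j\<^sub>i\<close> on products, and the zero subgroup as codomain gives
  the converse.
\<close>

lemma in_class_T_iff:
  "G \<in> gmr_class_T n \<longleftrightarrow>
    (\<forall>i\<in>I. \<forall>j\<in>I. i \<noteq> j \<longrightarrow> (\<forall>x\<in>P i j. \<forall>y\<in>P j i. x \<otimes> y = \<zero>))"
proof -
  have "(\<forall>t\<in>carrier (gmr_tensor G i j i). theta G i j i t = \<one>\<^bsub>bim G i i\<^esub>) \<longleftrightarrow>
      (\<forall>x\<in>P i j. \<forall>y\<in>P j i. x \<otimes> y = \<zero>)" if ij: "i \<in> I" "j \<in> I" for i j
  proof -
    have one: "\<one>\<^bsub>bim G i i\<^esub> = \<zero>" by (simp add: G_simps)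
    show ?thesis
      unfolding one
      using pure_closed[OF ij ij(1)] theta_pure[OF ij ij(1)]
        theta_in_subgroup[OF ij ij(1) add.triv_subgroup]
      by auto
  qed
  then show ?thesis
    using generalized_matrix_ring_G by (auto simp: gmr_class_T_def)
qed

text \<open>
  Doubling the middle idempotent shows that the generators of \<open>e\<^sub>i R e\<^sub>j R e\<^sub>i\<close> are precisely the
  products of elements of \<open>P\<^sub>i\<^sub>j\<close> and \<open>P\<^sub>j\<^sub>i\<close>.
\<close>

lemma corner_products_zero_iff_triple:
  assumes "i \<in> I" "j \<in> I"
  shows "(\<forall>x\<in>P i j. \<forall>y\<in>P j i. x \<otimes> y = \<zero>) \<longleftrightarrow> peirce_triple R (e i) (e j) = {\<zero>}"
proof -
  have "e i \<otimes> x \<otimes> e j \<otimes> y \<otimes> e i = (e i \<otimes> x \<otimes> e j) \<otimes> (e j \<otimes> y \<otimes> e i)"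
    if "x \<in> carrier R" "y \<in> carrier R" for x y
  proof -
    have "e i \<otimes> x \<otimes> e j \<otimes> y \<otimes> e i = e i \<otimes> x \<otimes> (e j \<otimes> e j) \<otimes> y \<otimes> e i"
      using assms by simp
    then show ?thesis
      using that assms by (simp add: m_assoc del: e_idem)
  qed
  then have products: "{e i \<otimes> x \<otimes> e j \<otimes> y \<otimes> e i | x y. x \<in> carrier R \<and> y \<in> carrier R} =
      {x \<otimes> y | x y. x \<in> P i j \<and> y \<in> P j i}"
    unfolding peirce_part_def by (auto; metis)
  show ?thesis
    unfolding peirce_triple_def products
  proof
    assume "\<forall>x\<in>P i j. \<forall>y\<in>P j i. x \<otimes> y = \<zero>"
    then have "generate (add_monoid R) {x \<otimes> y | x y. x \<in> P i j \<and> y \<in> P j i} \<subseteq> {\<zero>}"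
      using add.triv_subgroup by (intro add.generate_subgroup_incl) auto
    then show "generate (add_monoid R) {x \<otimes> y | x y. x \<in> P i j \<and> y \<in> P j i} = {\<zero>}"
      using generate.one[of "add_monoid R"] by auto
  next
    assume "generate (add_monoid R) {x \<otimes> y | x y. x \<in> P i j \<and> y \<in> P j i} = {\<zero>}"
    then show "\<forall>x\<in>P i j. \<forall>y\<in>P j i. x \<otimes> y = \<zero>"
      using generate.incl[of _ "{x \<otimes> y | x y. x \<in> P i j \<and> y \<in> P j i}" "add_monoid R"] by blast
  qed
qed

text \<open>
  The comparison works for each index separately: triviality of \<open>e\<^sub>i\<close> concerns just the mixed
  products that start and end at \<open>i\<close>.
\<close>

lemma inner_peirce_trivial_iff:
  assumes i: "i \<in> I"
  shows "e i \<in> inner_peirce_trivial R \<longleftrightarrow>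
    (\<forall>j\<in>I. i \<noteq> j \<longrightarrow> (\<forall>x\<in>P i j. \<forall>y\<in>P j i. x \<otimes> y = \<zero>))"
proof
  assume triv: "e i \<in> inner_peirce_trivial R"
  show "\<forall>j\<in>I. i \<noteq> j \<longrightarrow> (\<forall>x\<in>P i j. \<forall>y\<in>P j i. x \<otimes> y = \<zero>)"
  proof (intro ballI impI)
    fix j x y assume j: "j \<in> I" "i \<noteq> j" and x: "x \<in> P i j" and y: "y \<in> P j i"
    then have c: "x \<in> carrier R" "y \<in> carrier R"
      using i P_carrier by blast+
    have "x \<otimes> y = e i \<otimes> x \<otimes> y \<otimes> e i"
      using i j x y c by (simp add: P_iff m_assoc)
    also have "\<dots> = e i \<otimes> x \<otimes> e i \<otimes> y \<otimes> e i"
      using triv c by (simp add: inner_peirce_trivial_def)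
    \<comment> \<open>\<open>x\<close> ends in \<open>e\<^sub>j\<close>, which is orthogonal to the inserted \<open>e\<^sub>i\<close>.\<close>
    also have "\<dots> = e i \<otimes> (x \<otimes> e i) \<otimes> y \<otimes> e i"
      using i c by (simp add: m_assoc)
    also have "\<dots> = \<zero>"
      using i j c P_mult_e[OF i i j(1) x] by simp
    finally show "x \<otimes> y = \<zero>" .
  qed
next
  assume zero: "\<forall>j\<in>I. i \<noteq> j \<longrightarrow> (\<forall>x\<in>P i j. \<forall>y\<in>P j i. x \<otimes> y = \<zero>)"
  have "e i \<otimes> x \<otimes> y \<otimes> e i = e i \<otimes> x \<otimes> e i \<otimes> y \<otimes> e i"
    if x: "x \<in> carrier R" and y: "y \<in> carrier R" for x y
  proof -
    have "e i \<otimes> x \<otimes> y \<otimes> e i = (\<Oplus>j\<in>I. (e i \<otimes> x) \<otimes> e j \<otimes> (y \<otimes> e i))"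
      using mult_expand[of "e i \<otimes> x" "y \<otimes> e i"] i x y by (simp add: m_assoc)
    also have "\<dots> = (\<Oplus>j\<in>I. if i = j then (e i \<otimes> x) \<otimes> e j \<otimes> (y \<otimes> e i) else \<zero>)"
    proof (rule add.finprod_cong')
      fix j assume j: "j \<in> I"
      have "(e i \<otimes> x) \<otimes> e j \<otimes> (y \<otimes> e i) = (e i \<otimes> x) \<otimes> (e j \<otimes> e j) \<otimes> (y \<otimes> e i)"
        using j by simp
      also have "\<dots> = (e i \<otimes> x \<otimes> e j) \<otimes> (e j \<otimes> y \<otimes> e i)"
        using i j x y by (simp add: m_assoc del: e_idem)
      finally have *: "(e i \<otimes> x) \<otimes> e j \<otimes> (y \<otimes> e i) = (e i \<otimes> x \<otimes> e j) \<otimes> (e j \<otimes> y \<otimes> e i)" .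
      show "(e i \<otimes> x) \<otimes> e j \<otimes> (y \<otimes> e i) =
          (if i = j then (e i \<otimes> x) \<otimes> e j \<otimes> (y \<otimes> e i) else \<zero>)"
      proof (cases "i = j")
        case False
        have "e i \<otimes> x \<otimes> e j \<in> P i j" "e j \<otimes> y \<otimes> e i \<in> P j i"
          using x y by (auto simp: peirce_part_def)
        with False zero j have "(e i \<otimes> x \<otimes> e j) \<otimes> (e j \<otimes> y \<otimes> e i) = \<zero>"
          by blast
        with * False show ?thesis by simp
      qed simp
    qed (use i x y in auto)
    also have "\<dots> = (e i \<otimes> x) \<otimes> e i \<otimes> (y \<otimes> e i)"
      using i x y by (intro finsum_singleton) auto
    finally show ?thesis
      using i x y by (simp add: m_assoc)
  qed
  then show "e i \<in> inner_peirce_trivial R"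
    using i by (simp add: inner_peirce_trivial_def)
qed

lemma zero_diagonal_additive_subgroup: "additive_subgroup (zero_diagonal_arrays n G) G"
proof -
  interpret G: ring G by (rule ring_G)
  let ?D = "zero_diagonal_arrays n G"
  have D: "A \<in> ?D \<longleftrightarrow> A \<in> carrier G \<and> (\<forall>i\<in>I. A i i = \<zero>)" for A
    by (simp add: zero_diagonal_arrays_def G_simps peirce_diag_ring_def)
  show ?thesis
  proof (intro additive_subgroup.intro G.add.subgroupI)
    show "?D \<subseteq> carrier G"
      by (auto simp: D)
    have "\<zero>\<^bsub>G\<^esub> \<in> ?D"
      using G.zero_closed by (auto simp: D G_simps(4))
    then show "?D \<noteq> {}" by blast
  next
    fix A assume A: "A \<in> ?D"
    \<comment> \<open>The entries of the abstract inverse are read off from the equation \<open>- A + A = 0\<close>.\<close>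
    then have "(\<ominus>\<^bsub>G\<^esub> A) i i = \<zero>" if i: "i \<in> I" for i
    proof -
      have "(\<ominus>\<^bsub>G\<^esub> A \<oplus>\<^bsub>G\<^esub> A) i i = \<zero>"
        using A i by (simp add: D G.l_neg) (simp add: G_simps)
      moreover have "(\<ominus>\<^bsub>G\<^esub> A) i i \<in> carrier R"
        using A i G.a_inv_closed[of A] P_carrier[OF i i] by (auto simp: D G_simps PiE_iff)
      ultimately show ?thesis
        using A i by (simp add: D G_simps)
    qed
    with A show "\<ominus>\<^bsub>G\<^esub> A \<in> ?D"
      by (simp add: D)
    fix B assume B: "B \<in> ?D"
    have "(A \<oplus>\<^bsub>G\<^esub> B) i i = \<zero>" if "i \<in> I" for i
      using A B that by (simp add: D G_simps)
    with A B show "A \<oplus>\<^bsub>G\<^esub> B \<in> ?D"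
      by (simp add: D)
  qed
qed

definition matrix_unit :: "nat \<Rightarrow> nat \<Rightarrow> 'a \<Rightarrow> nat \<Rightarrow> nat \<Rightarrow> 'a" where
  "matrix_unit i j x = (\<lambda>k\<in>I. \<lambda>l\<in>I. if k = i \<and> l = j then x else \<zero>)"

lemma matrix_unit_closed: "x \<in> P i j \<Longrightarrow> matrix_unit i j x \<in> carrier G"
  using P_zero by (auto simp: matrix_unit_def G_simps)

text \<open>
  For a mixed product \<open>x y\<close>, the array with the single entry \<open>x\<close> at \<open>(i, j)\<close> lies off the diagonal,
  and multiplying it by the one with the single entry \<open>y\<close> at \<open>(j, i)\<close> puts \<open>x y\<close> on the diagonal.
\<close>

lemma zero_diagonal_right_ideal_iff:
  "right_ideal (zero_diagonal_arrays n G) G \<longleftrightarrow>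
    (\<forall>i\<in>I. \<forall>j\<in>I. i \<noteq> j \<longrightarrow> (\<forall>x\<in>P i j. \<forall>y\<in>P j i. x \<otimes> y = \<zero>))"
proof
  have D: "A \<in> zero_diagonal_arrays n G \<longleftrightarrow> A \<in> carrier G \<and> (\<forall>i\<in>I. A i i = \<zero>)" for A
    by (simp add: zero_diagonal_arrays_def G_simps peirce_diag_ring_def)
  {
    assume ideal: "right_ideal (zero_diagonal_arrays n G) G"
    show "\<forall>i\<in>I. \<forall>j\<in>I. i \<noteq> j \<longrightarrow> (\<forall>x\<in>P i j. \<forall>y\<in>P j i. x \<otimes> y = \<zero>)"
    proof (intro ballI impI)
      fix i j x y assume ij: "i \<in> I" "j \<in> I" "i \<noteq> j" and x: "x \<in> P i j" and y: "y \<in> P j i"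
      then have xy: "x \<in> carrier R" "y \<in> carrier R"
        using P_carrier by blast+
      have "matrix_unit i j x \<in> zero_diagonal_arrays n G"
        using ij x matrix_unit_closed by (auto simp: D matrix_unit_def)
      then have "matrix_unit i j x \<otimes>\<^bsub>G\<^esub> matrix_unit j i y \<in> zero_diagonal_arrays n G"
        using right_ideal.I_r_closed[OF ideal] matrix_unit_closed[OF y] by blast
      then have "(matrix_unit i j x \<otimes>\<^bsub>G\<^esub> matrix_unit j i y) i i = \<zero>"
        using ij by (simp add: D)
      moreover have "(matrix_unit i j x \<otimes>\<^bsub>G\<^esub> matrix_unit j i y) i i =
          (\<Oplus>k\<in>I. if j = k then x \<otimes> y else \<zero>)"
        using ij xy by (auto simp: G_simps matrix_unit_def intro!: add.finprod_cong')
      moreover have "\<dots> = x \<otimes> y"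
        using ij xy by (intro finsum_singleton) auto
      ultimately show "x \<otimes> y = \<zero>" by simp
    qed
  next
    assume zero: "\<forall>i\<in>I. \<forall>j\<in>I. i \<noteq> j \<longrightarrow> (\<forall>x\<in>P i j. \<forall>y\<in>P j i. x \<otimes> y = \<zero>)"
    interpret G: ring G by (rule ring_G)
    have "A \<otimes>\<^bsub>G\<^esub> B \<in> zero_diagonal_arrays n G"
      if A: "A \<in> zero_diagonal_arrays n G" and B: "B \<in> carrier G" for A B
    proof -
      have "A i k \<otimes> B k i = \<zero>" if i: "i \<in> I" and k: "k \<in> I" for i k
      proof (cases "i = k")
        case True
        moreover have "B k i \<in> carrier R"
          using B i k P_carrier[OF k i] by (auto simp: G_simps PiE_iff)
        ultimately show ?thesis
          using A i by (simp add: D)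
      next
        case False
        have "A i k \<in> P i k" "B k i \<in> P k i"
          using A B i k by (auto simp: D G_simps PiE_iff)
        with False zero i k show ?thesis by blast
      qed
      then have "(A \<otimes>\<^bsub>G\<^esub> B) i i = \<zero>" if "i \<in> I" for i
        using that by (simp add: G_simps cong: finsum_cong)
      then show ?thesis
        using A B by (simp add: D)
    qed
    then show "right_ideal (zero_diagonal_arrays n G) G"
      using zero_diagonal_additive_subgroup ring_G
      by (intro right_ideal.intro right_ideal_axioms.intro)
  }
qed

end

theorem theorem2p2:
  fixes R :: "('a, 'm) ring_scheme" and n :: nat and e :: "nat \<Rightarrow> 'a"
  assumes "ring R" and "n > 1" and "complete_orthogonal_idempotents R n e"
  shows "(peirce_ring R n e \<in> gmr_class_T n \<longleftrightarrow>
            (\<forall>i\<in>{1..n}. \<forall>j\<in>{1..n}. i \<noteq> j \<longrightarrow> peirce_triple R (e i) (e j) = {\<zero>\<^bsub>R\<^esub>})) \<and>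
         ((\<forall>i\<in>{1..n}. \<forall>j\<in>{1..n}. i \<noteq> j \<longrightarrow> peirce_triple R (e i) (e j) = {\<zero>\<^bsub>R\<^esub>}) \<longleftrightarrow>
            e ` {1..n} \<subseteq> inner_peirce_trivial R) \<and>
         (e ` {1..n} \<subseteq> inner_peirce_trivial R \<longleftrightarrow>
            right_ideal (zero_diagonal_arrays n (peirce_ring R n e)) (peirce_ring R n e))"
proof -
  interpret peirce_decomposition R n e
    using assms(1,3) by (intro peirce_decomposition.intro peirce_decomposition_axioms.intro)
  let ?zero = "\<forall>i\<in>I. \<forall>j\<in>I. i \<noteq> j \<longrightarrow> (\<forall>x\<in>P i j. \<forall>y\<in>P j i. x \<otimes>\<^bsub>R\<^esub> y = \<zero>\<^bsub>R\<^esub>)"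
  have "(\<forall>i\<in>I. \<forall>j\<in>I. i \<noteq> j \<longrightarrow> peirce_triple R (e i) (e j) = {\<zero>\<^bsub>R\<^esub>}) \<longleftrightarrow> ?zero"
    by (simp cong: ball_cong_simp add: corner_products_zero_iff_triple)
  moreover have "e ` I \<subseteq> inner_peirce_trivial R \<longleftrightarrow> ?zero"
    unfolding image_subset_iff by (simp cong: ball_cong_simp add: inner_peirce_trivial_iff)
  ultimately show ?thesis
    using in_class_T_iff zero_diagonal_right_ideal_iff by simp
qed

end
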